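(* Let $M$ be a smooth oriented surface immersed into $\mathbb R^4$, with Gauss map $g=(g_1,g_2):M\to S_1\times S_2$. Let $(e_1,e_2,e_3,e_4)$ be a local Darboux frame on $M$ with connection forms $\omega_i^j$. Then, on the domain of the frame, the kernel of $dg_1$ coincides with the kernel of the Pfaffian system $\{\omega_1^3-\omega_2^4=0,\ \omega_1^4+\omega_2^3=0\}$. Moreover, the kernel of $dg_2$ coincides with the kernel of the Pfaffian system $\{\omega_2^4+\omega_1^3=0,\ \omega_1^4-\omega_2^3=0\}$.
   Context: A local Darboux frame $(e_1,e_2,e_3,e_4)$ on an open subset of $M$ is a smooth positive orthonormal frame of $\mathbb R^4$ along $M$ such that $(e_1,e_2)$ is a positive orthonormal basis of each tangent plane and $(e_3,e_4)$ is an orthonormal basis of each normal plane. The connection $1$-forms $\omega_i^j$ on $M$ are defined by $de_i(X)=\sum_{j=1}^4\omega_i^j(X)e_j$, i.e. $\omega_i^j=\langle de_i,e_j\rangle$. The space $\Lambda^2\mathbb R^4$ carries the inner product $\langle u_1\wedge u_2,w_1\wedge w_2\rangle=\det(\langle u_i,w_j\rangle)$. The oriented Grassmannian $Gr^+(2,4)$ of oriented planes in $\mathbb R^4$ is identified with a subset of $\Lambda^2\mathbb R^4$ by sending an oriented plane with positive orthonormal basis $(v_1,v_2)$ to $v_1\wedge v_2$. For a positive orthonormal basis $(e_1,\dots,e_4)$ of $\mathbb R^4$ put $x_1=\frac1{\sqrt2}(e_1\wedge e_2+e_3\wedge e_4)$, $x_2=\frac1{\sqrt2}(e_2\wedge e_3+e_1\wedge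 e_4)$, $x_3=\frac1{\sqrt2}(e_3\wedge e_1+e_2\wedge e_4)$, $y_1=\frac1{\sqrt2}(e_1\wedge e_2-e_3\wedge e_4)$, $y_2=\frac1{\sqrt2}(e_2\wedge e_3-e_1\wedge e_4)$, $y_3=\frac1{\sqrt2}(e_3\wedge e_1-e_2\wedge e_4)$. Then $Gr^+(2,4)=S_1\times S_2$, where $S_1$ and $S_2$ are the spheres of radius $\frac1{\sqrt2}$ centred at $0$ in $\mathrm{span}(x_1,x_2,x_3)$ and $\mathrm{span}(y_1,y_2,y_3)$ (these spans do not depend on the chosen positive orthonormal basis). The Gauss map is $g(p)=e_1(p)\wedge e_2(p)$, and its components are $g_1(p)=\frac12(e_1(p)\wedge e_2(p)+e_3(p)\wedge e_4(p))\in S_1$ and $g_2(p)=\frac12(e_1(p)\wedge e_2(p)-e_3(p)\wedge e_4(p))\in S_2$; these do not depend on the choice of Darboux frame. The kernel of a Pfaffian system $\{\alpha=0,\beta=0\}$ at a point $q$ is $\{v\in T_qM:\alpha_q(v)=\beta_q(v)=0\}$. *)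

theory Defs
  imports "HOL-Analysis.Analysis"
begin

section \<open>Smooth maps between Euclidean spaces\<close>

text \<open>Meant for open sets: differentiability is taken at full neighbourhoods.\<close>

primrec Ck_on :: "nat \<Rightarrow> ('a::euclidean_space \<Rightarrow> 'b::real_normed_vector) \<Rightarrow> 'a set \<Rightarrow> bool" where
  "Ck_on 0 f S \<longleftrightarrow> continuous_on S f"
| "Ck_on (Suc k) f S \<longleftrightarrow>
     (\<forall>x\<in>S. f differentiable (at x)) \<and> (\<forall>v. Ck_on k (\<lambda>x. frechet_derivative f (at x) v) S)"

definition smooth_on :: "('a::euclidean_space \<Rightarrow> 'b::real_normed_vector) \<Rightarrow> 'a set \<Rightarrow> bool" where
  "smooth_on f S \<longleftrightarrow> (\<forall>k. Ck_on k f S)"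


section \<open>Oriented smooth surfaces\<close>

text \<open>A chart is a pair of its domain and its coordinate map. The coordinate map is only
  relevant on the domain.\<close>

type_synonym 'a chart = "'a set \<times> ('a \<Rightarrow> real^2)"

definition is_chart :: "'a topology \<Rightarrow> 'a chart \<Rightarrow> bool" where
  "is_chart X c \<longleftrightarrow> openin X (fst c) \<and> open (snd c ` fst c) \<and>
     homeomorphic_map (subtopology X (fst c)) (top_of_set (snd c ` fst c)) (snd c)"

definition chart_inv :: "'a chart \<Rightarrow> real^2 \<Rightarrow> 'a" where
  "chart_inv c = inv_into (fst c) (snd c)"

definition transition :: "'a chart \<Rightarrow> 'a chart \<Rightarrow> real^2 \<Rightarrow> real^2" where
  "transition c d = snd d \<circ> chart_inv c"

text \<open>The smooth structure and the orientation are both given by an atlas (not necessarily a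
  maximal one) whose transition maps are smooth and orientation preserving.\<close>

definition oriented_surface :: "'a topology \<Rightarrow> 'a chart set \<Rightarrow> bool" where
  "oriented_surface X A \<longleftrightarrow>
     Hausdorff_space X \<and> second_countable X \<and>
     (\<forall>c\<in>A. is_chart X c) \<and> (\<Union>c\<in>A. fst c) = topspace X \<and>
     (\<forall>c\<in>A. \<forall>d\<in>A. smooth_on (transition c d) (snd c ` (fst c \<inter> fst d)) \<and>
        (\<forall>x \<in> snd c ` (fst c \<inter> fst d).
           det (matrix (frechet_derivative (transition c d) (at x))) > 0))"

definition smooth_map_on :: "'a chart set \<Rightarrow> 'a set \<Rightarrow> ('a \<Rightarrow> 'b::real_normed_vector) \<Rightarrow> bool" where
  "smooth_map_on A U F \<longleftrightarrow> (\<forall>c\<in>A. smooth_on (F \<circ> chart_inv c) (snd c ` (fst c \<inter> U)))"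

definition charts_at :: "'a chart set \<Rightarrow> 'a \<Rightarrow> 'a chart set" where
  "charts_at A p = {c \<in> A. p \<in> fst c}"

text \<open>A tangent vector at \<open>p\<close> is the family of its coordinate vectors in all charts around \<open>p\<close>,
  which transform by the derivatives of the transition maps. The value \<open>0\<close> at all other charts
  is a convention that makes equality of tangent vectors coincide with equality of functions.\<close>

type_synonym 'a tangent_vector = "'a chart \<Rightarrow> real^2"

definition tangent_space :: "'a chart set \<Rightarrow> 'a \<Rightarrow> 'a tangent_vector set" where
  "tangent_space A p = {v.
     (\<forall>c\<in>charts_at A p. \<forall>d\<in>charts_at A p.
        v d = frechet_derivative (transition c d) (at (snd c p)) (v c)) \<and>
     (\<forall>c. c \<notin> charts_at A p \<longrightarrow> v c = 0)}"

text \<open>By the chain rule, the choice of the chart is irrelevant for \<open>F\<close> smooth near \<open>p\<close>.\<close>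

definition differential ::
  "'a chart set \<Rightarrow> ('a \<Rightarrow> 'b::real_normed_vector) \<Rightarrow> 'a \<Rightarrow> 'a tangent_vector \<Rightarrow> 'b" where
  "differential A F p v =
     (let c = (SOME c. c \<in> charts_at A p)
      in frechet_derivative (F \<circ> chart_inv c) (at (snd c p)) (v c))"

definition kernel_differential ::
  "'a chart set \<Rightarrow> ('a \<Rightarrow> 'b::real_normed_vector) \<Rightarrow> 'a \<Rightarrow> 'a tangent_vector set" where
  "kernel_differential A F p = {v \<in> tangent_space A p. differential A F p v = 0}"

definition kernel_pfaffian ::
  "'a chart set \<Rightarrow> ('a \<Rightarrow> 'a tangent_vector \<Rightarrow> real) \<Rightarrow> ('a \<Rightarrow> 'a tangent_vector \<Rightarrow> real) \<Rightarrow>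
   'a \<Rightarrow> 'a tangent_vector set" where
  "kernel_pfaffian A \<alpha> \<beta> p = {v \<in> tangent_space A p. \<alpha> p v = 0 \<and> \<beta> p v = 0}"

definition positive_pair ::
  "'a chart set \<Rightarrow> 'a \<Rightarrow> 'a tangent_vector \<Rightarrow> 'a tangent_vector \<Rightarrow> bool" where
  "positive_pair A p v w \<longleftrightarrow> (\<forall>c\<in>charts_at A p. det (vector [v c, w c] :: real^2^2) > 0)"


section \<open>Bivectors\<close>

lemma transpose_linear:
  fixes B C :: "real^'n^'m"
  shows "transpose (0 :: real^'n^'m) = 0"
    and "transpose (B + C) = transpose B + transpose C"
    and "transpose (B - C) = transpose B - transpose C"
    and "transpose (- B) = - transpose B"
    and "transpose (a *\<^sub>R B) = a *\<^sub>R transpose B"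
  by (simp_all add: transpose_def vec_eq_iff)

text \<open>The space \<open>\<Lambda>\<^sup>2\<real>\<^sup>4\<close> is realised by the skew-symmetric matrices. The factor \<open>1/2\<close> in the
  inner product makes it the determinant on decomposable bivectors, see \<open>inner_wedge\<close>.\<close>

typedef bivector = "{B :: real^4^4. transpose B = - B}"
  morphisms mat_of_bivector Bivector
  by (rule exI[of _ 0]) (simp add: transpose_linear)

setup_lifting type_definition_bivector

instantiation bivector :: real_inner
begin

lift_definition zero_bivector :: bivector is 0
  by (simp add: transpose_linear)

lift_definition plus_bivector :: "bivector \<Rightarrow> bivector \<Rightarrow> bivector" is "(+)"
  by (simp add: transpose_linear)

lift_definition minus_bivector :: "bivector \<Rightarrow> bivector \<Rightarrow> bivector" is "(-)"
  by (simp add: transpose_linear)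

lift_definition uminus_bivector :: "bivector \<Rightarrow> bivector" is uminus
  by (simp add: transpose_linear)

lift_definition scaleR_bivector :: "real \<Rightarrow> bivector \<Rightarrow> bivector" is "(*\<^sub>R)"
  by (simp add: transpose_linear)

lift_definition inner_bivector :: "bivector \<Rightarrow> bivector \<Rightarrow> real" is "\<lambda>B C. inner B C / 2" .

definition norm_bivector :: "bivector \<Rightarrow> real" where
  "norm_bivector x = sqrt (inner x x)"

definition dist_bivector :: "bivector \<Rightarrow> bivector \<Rightarrow> real" where
  "dist_bivector x y = norm (x - y)"

definition sgn_bivector :: "bivector \<Rightarrow> bivector" where
  "sgn_bivector x = inverse (norm x) *\<^sub>R x"

definition uniformity_bivector :: "(bivector \<times> bivector) filter" where
  "uniformity_bivector = (INF e\<in>{0 <..}. principal {(x, y). dist x y < e})"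

definition open_bivector :: "bivector set \<Rightarrow> bool" where
  "open_bivector U \<longleftrightarrow> (\<forall>x\<in>U. \<forall>\<^sub>F (x', y) in uniformity. x' = x \<longrightarrow> y \<in> U)"

instance
proof
  fix x y z :: bivector and a b :: real
  show "x + y + z = x + (y + z)"
    by transfer (simp add: add.assoc)
  show "x + y = y + x"
    by transfer (simp add: add.commute)
  show "0 + x = x"
    by transfer simp
  show "- x + x = 0"
    by transfer simp
  show "x - y = x + - y"
    by transfer simp
  show "a *\<^sub>R (x + y) = a *\<^sub>R x + a *\<^sub>R y"
    by transfer (simp add: scaleR_add_right)
  show "(a + b) *\<^sub>R x = a *\<^sub>R x + b *\<^sub>R x"
    by transfer (simp add: scaleR_add_left)
  show "a *\<^sub>R b *\<^sub>R x = (a * b) *\<^sub>R x"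
    by transfer simp
  show "1 *\<^sub>R x = x"
    by transfer simp
  show "inner x y = inner y x"
    by transfer (simp add: inner_commute)
  show "inner (x + y) z = inner x z + inner y z"
    by transfer (simp add: inner_add_left add_divide_distrib)
  show "inner (a *\<^sub>R x) y = a * inner x y"
    by transfer simp
  show "0 \<le> inner x x"
    by transfer simp
  show "inner x x = 0 \<longleftrightarrow> x = 0"
    by transfer simp
qed (simp_all add: norm_bivector_def dist_bivector_def sgn_bivector_def uniformity_bivector_def
       open_bivector_def)

end

lift_definition wedge :: "real^4 \<Rightarrow> real^4 \<Rightarrow> bivector" (infixr "\<and>\<^sub>2" 72)
  is "\<lambda>u w. \<chi> i j. u$i * w$j - u$j * w$i"
  by (simp add: transpose_def vec_eq_iff)

lemma inner_wedge:
  "inner (u1 \<and>\<^sub>2 u2) (w1 \<and>\<^sub>2 w2) =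
     det (vector [vector [inner u1 w1, inner u1 w2], vector [inner u2 w1, inner u2 w2]] :: real^2^2)"
proof -
  have "inner (u1 \<and>\<^sub>2 u2) (w1 \<and>\<^sub>2 w2) =
      (\<Sum>i\<in>UNIV. \<Sum>j\<in>UNIV. (u1$i * u2$j - u1$j * u2$i) * (w1$i * w2$j - w1$j * w2$i)) / 2"
    by transfer (simp add: inner_vec_def)
  also have "\<dots> = ((\<Sum>i\<in>UNIV. \<Sum>j\<in>UNIV. (u1$i * w1$i) * (u2$j * w2$j))
      + (\<Sum>i\<in>UNIV. \<Sum>j\<in>UNIV. (u2$i * w2$i) * (u1$j * w1$j))
      - (\<Sum>i\<in>UNIV. \<Sum>j\<in>UNIV. (u1$i * w2$i) * (u2$j * w1$j))
      - (\<Sum>i\<in>UNIV. \<Sum>j\<in>UNIV. (u2$i * w1$i) * (u1$j * w2$j))) / 2"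
    unfolding sum.distrib [symmetric] sum_subtractf [symmetric]
    by (intro arg_cong2 [where f = "(/)"] sum.cong refl) (simp only: algebra_simps)
  also have "\<dots> = inner u1 w1 * inner u2 w2 - inner u1 w2 * inner u2 w1"
    by (simp only: sum_product [symmetric] inner_vec_def inner_real_def) simp
  finally show ?thesis
    by (simp add: det_2)
qed


section \<open>Surfaces immersed into 4-space, Darboux frames and the Gauss map\<close>

definition immersion :: "'a topology \<Rightarrow> 'a chart set \<Rightarrow> ('a \<Rightarrow> real^4) \<Rightarrow> bool" where
  "immersion X A f \<longleftrightarrow> smooth_map_on A (topspace X) f \<and>
     (\<forall>p\<in>topspace X. inj_on (differential A f p) (tangent_space A p))"

definition tangent_plane :: "'a chart set \<Rightarrow> ('a \<Rightarrow> real^4) \<Rightarrow> 'a \<Rightarrow> (real^4) set" where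
  "tangent_plane A f p = differential A f p ` tangent_space A p"

text \<open>The indices of a frame are the elements \<open>1, 2, 3, 4\<close> of the numeral type \<open>4\<close> (in which
  \<open>4 = 0\<close>), the index type of \<open>real^4\<close>. Hence the determinant below is that of \<open>b\<close> with respect
  to the standard basis in its usual order.\<close>

definition darboux_basis :: "'a chart set \<Rightarrow> ('a \<Rightarrow> real^4) \<Rightarrow> 'a \<Rightarrow> (4 \<Rightarrow> real^4) \<Rightarrow> bool" where
  "darboux_basis A f p b \<longleftrightarrow>
     (\<forall>i j. inner (b i) (b j) = (if i = j then 1 else 0)) \<and>
     det (\<chi> i. b i) > 0 \<and>
     span {b 1, b 2} = tangent_plane A f p \<and>
     (\<exists>v\<in>tangent_space A p. \<exists>w\<in>tangent_space A p.
        differential A f p v = b 1 \<and> differential A f p w = b 2 \<and> positive_pair A p v w) \<and>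
     span {b 3, b 4} = (tangent_plane A f p)\<^sup>\<bottom>"

definition darboux_frame ::
  "'a topology \<Rightarrow> 'a chart set \<Rightarrow> ('a \<Rightarrow> real^4) \<Rightarrow> 'a set \<Rightarrow> (4 \<Rightarrow> 'a \<Rightarrow> real^4) \<Rightarrow> bool" where
  "darboux_frame X A f U e \<longleftrightarrow> openin X U \<and> (\<forall>i. smooth_map_on A U (e i)) \<and>
     (\<forall>p\<in>U. darboux_basis A f p (\<lambda>i. e i p))"

definition connection_form ::
  "'a chart set \<Rightarrow> (4 \<Rightarrow> 'a \<Rightarrow> real^4) \<Rightarrow> 4 \<Rightarrow> 4 \<Rightarrow> 'a \<Rightarrow> 'a tangent_vector \<Rightarrow> real" where
  "connection_form A e i j p v = inner (differential A (e i) p v) (e j p)"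

text \<open>The components of the Gauss map \<open>p \<mapsto> e\<^sub>1 \<and> e\<^sub>2\<close> in the two sphere factors of the
  oriented Grassmannian. The values do not depend on the Darboux basis.\<close>

definition gauss_map_1 :: "'a chart set \<Rightarrow> ('a \<Rightarrow> real^4) \<Rightarrow> 'a \<Rightarrow> bivector" where
  "gauss_map_1 A f p =
     (THE w. \<exists>b. darboux_basis A f p b \<and> w = (1/2) *\<^sub>R (b 1 \<and>\<^sub>2 b 2 + b 3 \<and>\<^sub>2 b 4))"

definition gauss_map_2 :: "'a chart set \<Rightarrow> ('a \<Rightarrow> real^4) \<Rightarrow> 'a \<Rightarrow> bivector" where
  "gauss_map_2 A f p =
     (THE w. \<exists>b. darboux_basis A f p b \<and> w = (1/2) *\<^sub>R (b 1 \<and>\<^sub>2 b 2 - b 3 \<and>\<^sub>2 b 4))"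

end

theory Submission
  imports Defs
begin

text \<open>Both components of the Gauss map have the form
  \<open>g\<^sub>s = 1/2 (e\<^sub>1 \<and> e\<^sub>2 + s e\<^sub>3 \<and> e\<^sub>4)\<close> with \<open>s = 1\<close> or \<open>s = - 1\<close>, so one computation serves for
  both. By the product rule, the differential of \<open>g\<^sub>s\<close> is a sum of wedges in which one factor
  \<open>e\<^sub>i\<close> is replaced by \<open>de\<^sub>i = \<Sum>\<^sub>j \<omega>\<^sub>i\<^sup>j e\<^sub>j\<close>. Since the frame is orthonormal, the connection
  forms are skew in \<open>i\<close> and \<open>j\<close> (\<open>differential_of_orthonormal_frame_skew\<close>). The forms
  \<open>\<omega>\<^sub>1\<^sup>2\<close> and \<open>\<omega>\<^sub>3\<^sup>4\<close> cancel, the other terms group in pairs because \<open>s\<^sup>2 = 1\<close>, and what remains is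
  \<open>2 dg\<^sub>s = - (\<omega>\<^sub>1\<^sup>3 - s \<omega>\<^sub>2\<^sup>4) (e\<^sub>2 \<and> e\<^sub>3 + s e\<^sub>1 \<and> e\<^sub>4) - (\<omega>\<^sub>1\<^sup>4 + s \<omega>\<^sub>2\<^sup>3) (e\<^sub>2 \<and> e\<^sub>4 + s e\<^sub>3 \<and> e\<^sub>1)\<close>
  (\<open>skew_derivative_of_wedges\<close>). The two bivectors on the right are linearly independent: they are
  multiples of \<open>x\<^sub>2, x\<^sub>3\<close> or \<open>y\<^sub>2, y\<^sub>3\<close>, which span the tangent plane of the sphere at \<open>g\<^sub>s\<close>. Hence
  \<open>dg\<^sub>s\<close> vanishes exactly where both coefficients do (\<open>kernel_differential_gauss_component\<close>).

  The Gauss map is defined pointwise by an arbitrary Darboux basis. To differentiate it along the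
  given frame one has to know that \<open>e\<^sub>1 \<and> e\<^sub>2\<close> and \<open>e\<^sub>3 \<and> e\<^sub>4\<close> depend only on the oriented tangent
  plane (\<open>darboux_basis_wedges_unique\<close>): a change of Darboux basis is a rotation in the tangent
  plane and one in the normal plane, and a wedge in a plane changes by the determinant.\<close>

section \<open>Bivectors\<close>

lemma wedge_self [simp]: "u \<and>\<^sub>2 u = 0"
  by transfer (simp add: vec_eq_iff)

lemma wedge_commute: "u \<and>\<^sub>2 w = - (w \<and>\<^sub>2 u)"
  by transfer (simp add: vec_eq_iff)

text \<open>Lagrange's identity. The bound makes the wedge a bounded bilinear map, which gives the product
  rule for it.\<close>

lemma norm_wedge_le: "norm (u \<and>\<^sub>2 w) \<le> norm u * norm w"
proof -
  have "(norm (u \<and>\<^sub>2 w))\<^sup>2 = (norm u)\<^sup>2 * (norm w)\<^sup>2 - (inner u w)\<^sup>2"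
    unfolding power2_norm_eq_inner inner_wedge
    by (simp add: det_2 inner_commute power2_eq_square)
  also have "\<dots> \<le> (norm u * norm w)\<^sup>2"
    by (simp add: power_mult_distrib)
  finally show ?thesis
    by (rule power2_le_imp_le) simp
qed

interpretation wedge: bounded_bilinear wedge
proof
  fix a a' b b' :: "real^4" and r :: real
  show "(a + a') \<and>\<^sub>2 b = a \<and>\<^sub>2 b + a' \<and>\<^sub>2 b"
    by transfer (simp add: vec_eq_iff algebra_simps)
  show "a \<and>\<^sub>2 (b + b') = a \<and>\<^sub>2 b + a \<and>\<^sub>2 b'"
    by transfer (simp add: vec_eq_iff algebra_simps)
  show "(r *\<^sub>R a) \<and>\<^sub>2 b = r *\<^sub>R (a \<and>\<^sub>2 b)"
    by transfer (simp add: vec_eq_iff algebra_simps)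
  show "a \<and>\<^sub>2 (r *\<^sub>R b) = r *\<^sub>R (a \<and>\<^sub>2 b)"
    by transfer (simp add: vec_eq_iff algebra_simps)
  show "\<exists>K. \<forall>a b. norm (a \<and>\<^sub>2 b) \<le> norm a * norm b * K"
    by (rule exI[of _ 1]) (simp add: norm_wedge_le)
qed

lemma wedge_linear_combination:
  "(a *\<^sub>R u + b *\<^sub>R w) \<and>\<^sub>2 (c *\<^sub>R u + d *\<^sub>R w) = (a * d - b * c) *\<^sub>R (u \<and>\<^sub>2 w)"
  using wedge_commute[of w u]
  by (simp add: wedge.add_left wedge.add_right wedge.scaleR_left wedge.scaleR_right
      scaleR_diff_left mult.commute)

section \<open>Orthonormal bases of 4-space\<close>

text \<open>A change of Darboux basis preserves the tangent and the normal plane, so that its matrix has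
  this shape.\<close>

lemma det_block_diagonal_4:
  fixes M :: "real^4^4"
  assumes "M$1$3 = 0" "M$1$4 = 0" "M$2$3 = 0" "M$2$4 = 0"
    and "M$3$1 = 0" "M$3$2 = 0" "M$4$1 = 0" "M$4$2 = 0"
  shows "det M = (M$1$1 * M$2$2 - M$1$2 * M$2$1) * (M$3$3 * M$4$4 - M$3$4 * M$4$3)"
proof -
  have f1: "finite {2::4, 3, 4}" "1 \<notin> {2::4, 3, 4}"
    and f2: "finite {3::4, 4}" "2 \<notin> {3::4, 4}"
    and f3: "finite {4::4}" "3 \<notin> {4::4}"
    by auto
  show ?thesis
    unfolding det_def UNIV_4
    unfolding sum_over_permutations_insert[OF f1]
    unfolding sum_over_permutations_insert[OF f2]
    unfolding sum_over_permutations_insert[OF f3]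
    unfolding permutes_sing
    by (simp add: sign_swap_id permutation_swap_id sign_compose sign_id swap_id_eq assms
        algebra_simps)
qed

text \<open>A matrix with orthonormal rows has its transpose as a right inverse, hence as a left
  inverse.\<close>

lemma orthonormal_expansion_4:
  fixes b :: "4 \<Rightarrow> real^4"
  assumes "\<And>i j. inner (b i) (b j) = (if i = j then 1 else 0)"
  shows "x = (\<Sum>i\<in>UNIV. inner x (b i) *\<^sub>R b i)"
proof -
  define B :: "real^4^4" where "B = (\<chi> i. b i)"
  have "B ** transpose B = mat 1"
    using assms by (simp add: B_def vec_eq_iff matrix_matrix_mult_def transpose_def mat_def
        inner_vec_def)
  then have "transpose B ** B = mat 1"
    by (simp add: matrix_left_right_inverse)
  then have "x = transpose B *v (B *v x)"
    by (simp add: matrix_vector_mul_assoc)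
  also have "\<dots> = (\<Sum>i\<in>UNIV. inner x (b i) *\<^sub>R b i)"
    by (simp add: B_def vec_eq_iff matrix_vector_mult_def transpose_def inner_vec_def
        sum_distrib_left mult.commute)
  finally show ?thesis .
qed

lemma span_pair_iff: "x \<in> span {u, w} \<longleftrightarrow> (\<exists>a b. x = a *\<^sub>R u + b *\<^sub>R w)"
  by (simp add: span_breakdown_eq diff_eq_eq add.commute)

text \<open>By Lagrange's identity for the coefficient rows, the square of the determinant is the Gram
  determinant of \<open>u', w'\<close>. So the determinant is \<open>1\<close> or \<open>- 1\<close>, and positivity decides.\<close>

lemma orthonormal_change_det:
  fixes u w :: "'v::real_inner"
  assumes "inner u u = 1" "inner w w = 1" "inner u w = 0"
    and "u' = a *\<^sub>R u + b *\<^sub>R w" "w' = c *\<^sub>R u + d *\<^sub>R w"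
    and "inner u' u' = 1" "inner w' w' = 1" "inner u' w' = 0"
    and "a * d - b * c > 0"
  shows "a * d - b * c = 1"
proof -
  have "inner w u = 0"
    using assms by (simp add: inner_commute)
  then have 1: "a*a + b*b = 1" "c*c + d*d = 1" "a*c + b*d = 0"
    using assms by (simp_all add: inner_add_left inner_add_right mult.commute)
  have "(a * d - b * c)\<^sup>2 = (a*a + b*b) * (c*c + d*d) - (a*c + b*d)\<^sup>2"
    by (simp add: power2_eq_square algebra_simps)
  then have "(a * d - b * c)\<^sup>2 = 1"
    by (simp add: 1)
  with assms(9) show ?thesis
    by (simp add: power2_eq_1_iff)
qed

section \<open>Charts and differentials\<close>

lemma smooth_on_differentiable:
  "smooth_on f S \<Longrightarrow> x \<in> S \<Longrightarrow> f differentiable (at x)"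
  unfolding smooth_on_def by (drule spec[of _ "Suc 0"]) simp

lemma chart_inv_eq:
  assumes "is_chart X c" "p \<in> fst c"
  shows "chart_inv c (snd c p) = p"
proof -
  have "topspace (subtopology X (fst c)) = fst c"
    using assms(1) openin_subset by (fastforce simp: is_chart_def)
  then have "inj_on (snd c) (fst c)"
    using assms(1) homeomorphic_imp_injective_map unfolding is_chart_def by metis
  then show ?thesis
    using assms(2) by (simp add: chart_inv_def)
qed

text \<open>The derivatives that define the differential are taken at full neighbourhoods in the
  coordinate plane. This supplies them.\<close>

lemma open_chart_image:
  assumes "is_chart X c" "openin X U"
  shows "open (snd c ` (fst c \<inter> U))"
proof -
  have "openin (subtopology X (fst c)) (fst c \<inter> U)"
    using assms(2) by (metis inf_commute openin_subtopology_Int)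
  then have "openin (top_of_set (snd c ` fst c)) (snd c ` (fst c \<inter> U))"
    using assms(1) homeomorphic_imp_open_map unfolding is_chart_def open_map_def by blast
  then show ?thesis
    using assms(1) openin_open_trans unfolding is_chart_def by blast
qed

text \<open>The transformation rule that defines tangent vectors is linear, because the transition maps
  are differentiable. At a point where a map is not differentiable, its Frechet derivative is an
  arbitrarily chosen function.\<close>

lemma tangent_space_linear_combination:
  assumes "oriented_surface X A"
    and v: "v \<in> tangent_space A p" and w: "w \<in> tangent_space A p"
  shows "(\<lambda>c. a *\<^sub>R v c + b *\<^sub>R w c) \<in> tangent_space A p"
proof -
  have lin: "linear (frechet_derivative (transition c d) (at (snd c p)))"
    if "c \<in> charts_at A p" "d \<in> charts_at A p" for c d
  proof (rule linear_frechet_derivative, rule smooth_on_differentiable)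
    show "smooth_on (transition c d) (snd c ` (fst c \<inter> fst d))"
      using that assms(1) by (auto simp: oriented_surface_def charts_at_def)
  qed (use that in \<open>auto simp: charts_at_def\<close>)
  have "a *\<^sub>R v d + b *\<^sub>R w d =
      frechet_derivative (transition c d) (at (snd c p)) (a *\<^sub>R v c + b *\<^sub>R w c)"
    if cd: "c \<in> charts_at A p" "d \<in> charts_at A p" for c d
  proof -
    have "v d = frechet_derivative (transition c d) (at (snd c p)) (v c)"
      "w d = frechet_derivative (transition c d) (at (snd c p)) (w c)"
      using v w cd unfolding tangent_space_def by blast+
    then show ?thesis
      by (simp only: linear_add[OF lin[OF cd]] linear_scale[OF lin[OF cd]])
  qed
  moreover have "a *\<^sub>R v c + b *\<^sub>R w c = 0" if "c \<notin> charts_at A p" for c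
    using v w that unfolding tangent_space_def by (simp del: split_paired_All)
  ultimately show ?thesis
    unfolding tangent_space_def by blast
qed

text \<open>The chart in which \<open>differential\<close> is computed. A name for it lets derivatives of maps with
  values in different spaces be compared in the same chart.\<close>

definition reference_chart :: "'a chart set \<Rightarrow> 'a \<Rightarrow> 'a chart" where
  "reference_chart A p = (SOME c. c \<in> charts_at A p)"

lemma differential_eq:
  "differential A F p v = frechet_derivative (F \<circ> chart_inv (reference_chart A p))
     (at (snd (reference_chart A p) p)) (v (reference_chart A p))"
  by (simp only: differential_def reference_chart_def Let_def)

lemma reference_chart:
  assumes "oriented_surface X A" "p \<in> topspace X"
  shows "reference_chart A p \<in> charts_at A p"
proof -
  have "p \<in> (\<Union>c\<in>A. fst c)"
    using assms unfolding oriented_surface_def by blast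
  then have "\<exists>c. c \<in> charts_at A p"
    unfolding charts_at_def by blast
  then show ?thesis
    unfolding reference_chart_def by (rule someI_ex)
qed

lemma chart_inv_reference_chart:
  assumes "oriented_surface X A" "p \<in> topspace X"
  shows "chart_inv (reference_chart A p) (snd (reference_chart A p) p) = p"
  using assms reference_chart[OF assms]
  by (intro chart_inv_eq[of X]) (auto simp: oriented_surface_def charts_at_def)

lemma has_derivative_reference_chart:
  assumes "oriented_surface X A" "openin X U" "p \<in> U" "smooth_map_on A U F"
  defines "c \<equiv> reference_chart A p"
  shows "((F \<circ> chart_inv c) has_derivative frechet_derivative (F \<circ> chart_inv c) (at (snd c p)))
    (at (snd c p))"
proof -
  have c: "c \<in> A" "p \<in> fst c"
    using reference_chart[OF assms(1)] openin_subset[OF assms(2)] assms(3)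
    by (auto simp: c_def charts_at_def)
  then have "F \<circ> chart_inv c differentiable (at (snd c p))"
    using assms(3,4) by (auto simp: smooth_map_on_def intro!: smooth_on_differentiable)
  then show ?thesis
    by (simp add: frechet_derivative_works)
qed

text \<open>The differential is local and is found from any derivative in the reference chart. Here
  \<open>G\<close> may be given in another way than the formula \<open>F\<close> that is differentiated, as the Gauss map
  is.\<close>

lemma differential_eqI:
  assumes S: "oriented_surface X A" and U: "openin X U" and p: "p \<in> U"
    and eq: "\<And>q. q \<in> U \<Longrightarrow> G q = F q"
  defines "c \<equiv> reference_chart A p"
  assumes D: "((F \<circ> chart_inv c) has_derivative D) (at (snd c p))"
  shows "differential A G p v = D (v c)"
proof -
  have "c \<in> charts_at A p"
    using reference_chart[OF S] openin_subset[OF U] p by (auto simp: c_def)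
  then have c: "is_chart X c" "p \<in> fst c"
    using S by (auto simp: charts_at_def oriented_surface_def)
  have "((G \<circ> chart_inv c) has_derivative D) (at (snd c p))"
  proof (rule has_derivative_transform_within_open[OF D open_chart_image[OF c(1) U]])
    show "snd c p \<in> snd c ` (fst c \<inter> U)"
      using c p by blast
  next
    fix y assume "y \<in> snd c ` (fst c \<inter> U)"
    then have "chart_inv c y \<in> U"
      using chart_inv_eq[OF c(1)] by auto
    then show "(F \<circ> chart_inv c) y = (G \<circ> chart_inv c) y"
      by (simp add: eq)
  qed
  from frechet_derivative_at[OF this] show ?thesis
    by (simp add: differential_eq c_def)
qed

lemma differential_linear_combination:
  assumes "oriented_surface X A" "openin X U" "p \<in> U" "smooth_map_on A U F"
  shows "differential A F p (\<lambda>c. a *\<^sub>R v c + b *\<^sub>R w c) =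
    a *\<^sub>R differential A F p v + b *\<^sub>R differential A F p w"
  using has_derivative_linear[OF has_derivative_reference_chart[OF assms]]
  by (simp add: differential_eq linear_add linear_scale)

section \<open>The Gauss map does not depend on the Darboux basis\<close>

text \<open>The coefficients that express \<open>b'\<^sub>1, b'\<^sub>2\<close> by \<open>b\<^sub>1, b\<^sub>2\<close> also express the tangent vectors behind
  them, since the differential of an immersion is injective. So the two orientations of the tangent
  plane agree only if the coefficient determinant is positive, and then it is \<open>1\<close>. The full change
  of basis has positive determinant, because both bases are positive in 4-space. Hence the
  determinant in the normal plane is positive as well, and it is \<open>1\<close>, too.\<close>

lemma darboux_basis_wedges_unique:
  assumes S: "oriented_surface X A" and f: "immersion X A f" and p: "p \<in> topspace X"
    and b: "darboux_basis A f p b" and b': "darboux_basis A f p b'"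
  shows "b' 1 \<and>\<^sub>2 b' 2 = b 1 \<and>\<^sub>2 b 2" and "b' 3 \<and>\<^sub>2 b' 4 = b 3 \<and>\<^sub>2 b 4"
proof -
  have on: "inner (b i) (b j) = (if i = j then 1 else 0)"
    "inner (b' i) (b' j) = (if i = j then 1 else 0)" for i j
    using b b' by (auto simp: darboux_basis_def)
  have "b' 1 \<in> span {b 1, b 2}" "b' 2 \<in> span {b 1, b 2}"
    "b' 3 \<in> span {b 3, b 4}" "b' 4 \<in> span {b 3, b 4}"
    using b b' by (auto simp: darboux_basis_def intro: span_base)
  then obtain a1 a2 a3 a4 c1 c2 c3 c4 where
    B1: "b' 1 = a1 *\<^sub>R b 1 + a2 *\<^sub>R b 2" and B2: "b' 2 = a3 *\<^sub>R b 1 + a4 *\<^sub>R b 2" and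
    B3: "b' 3 = c1 *\<^sub>R b 3 + c2 *\<^sub>R b 4" and B4: "b' 4 = c3 *\<^sub>R b 3 + c4 *\<^sub>R b 4"
    by (auto simp: span_pair_iff)
  obtain v w where v: "v \<in> tangent_space A p" "w \<in> tangent_space A p"
    "differential A f p v = b 1" "differential A f p w = b 2" "positive_pair A p v w"
    using b by (auto simp: darboux_basis_def)
  obtain v' w' where v': "v' \<in> tangent_space A p" "w' \<in> tangent_space A p"
    "differential A f p v' = b' 1" "differential A f p w' = b' 2" "positive_pair A p v' w'"
    using b' by (auto simp: darboux_basis_def)
  have sm: "smooth_map_on A (topspace X) f" and inj: "inj_on (differential A f p) (tangent_space A p)"
    using f p by (auto simp: immersion_def)
  note comb = tangent_space_linear_combination[OF S v(1,2)]
    differential_linear_combination[OF S openin_topspace p sm]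
  have v'_eq: "v' = (\<lambda>c. a1 *\<^sub>R v c + a2 *\<^sub>R w c)" and w'_eq: "w' = (\<lambda>c. a3 *\<^sub>R v c + a4 *\<^sub>R w c)"
    using v v' by (auto intro!: inj_onD[OF inj] simp: comb B1 B2)
  obtain c where "c \<in> charts_at A p"
    using reference_chart[OF S p] by blast
  then have pos: "det (vector [v c, w c] :: real^2^2) > 0" "det (vector [v' c, w' c] :: real^2^2) > 0"
    using v v' by (auto simp: positive_pair_def)
  have "det (vector [v' c, w' c] :: real^2^2) = (a1 * a4 - a2 * a3) * det (vector [v c, w c] :: real^2^2)"
    by (simp add: v'_eq w'_eq det_2 algebra_simps)
  then have "a1 * a4 - a2 * a3 > 0"
    using pos by (simp add: zero_less_mult_iff)
  then have d12: "a1 * a4 - a2 * a3 = 1"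
    by (intro orthonormal_change_det[OF _ _ _ B1 B2]) (simp_all add: on)
  \<comment> \<open>The matrix that takes \<open>b\<close> to \<open>b'\<close>.\<close>
  define M :: "real^4^4" where "M = (\<chi> i j. inner (b' i) (b j))"
  have "(\<chi> i. b' i) = M ** (\<chi> i. b i)"
    using orthonormal_expansion_4[of b "b' _", OF on(1)]
    by (simp add: M_def vec_eq_iff matrix_matrix_mult_def)
  moreover have "det M = (a1 * a4 - a2 * a3) * (c1 * c4 - c2 * c3)"
    by (subst det_block_diagonal_4) (simp_all add: M_def B1 B2 B3 B4 inner_add_left on)
  ultimately have "det (\<chi> i. b' i) =
      (a1 * a4 - a2 * a3) * (c1 * c4 - c2 * c3) * det (\<chi> i. b i)"
    by (simp add: det_mul)
  then have "c1 * c4 - c2 * c3 > 0"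
    using b b' d12 by (simp add: darboux_basis_def zero_less_mult_iff)
  then have d34: "c1 * c4 - c2 * c3 = 1"
    by (intro orthonormal_change_det[OF _ _ _ B3 B4]) (simp_all add: on)
  show "b' 1 \<and>\<^sub>2 b' 2 = b 1 \<and>\<^sub>2 b 2" and "b' 3 \<and>\<^sub>2 b' 4 = b 3 \<and>\<^sub>2 b 4"
    by (simp_all add: B1 B2 B3 B4 wedge_linear_combination d12 d34)
qed

lemma gauss_map_eq:
  assumes "oriented_surface X A" "immersion X A f" "p \<in> topspace X"
    and b: "darboux_basis A f p b"
  shows "gauss_map_1 A f p = (1/2) *\<^sub>R (b 1 \<and>\<^sub>2 b 2 + b 3 \<and>\<^sub>2 b 4)"
    and "gauss_map_2 A f p = (1/2) *\<^sub>R (b 1 \<and>\<^sub>2 b 2 - b 3 \<and>\<^sub>2 b 4)"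
proof -
  have eq: "b' 1 \<and>\<^sub>2 b' 2 = b 1 \<and>\<^sub>2 b 2" "b' 3 \<and>\<^sub>2 b' 4 = b 3 \<and>\<^sub>2 b 4"
    if "darboux_basis A f p b'" for b'
    using darboux_basis_wedges_unique[OF assms that] .
  show "gauss_map_1 A f p = (1/2) *\<^sub>R (b 1 \<and>\<^sub>2 b 2 + b 3 \<and>\<^sub>2 b 4)"
    unfolding gauss_map_1_def
  proof (rule the_equality)
    fix w assume "\<exists>b. darboux_basis A f p b \<and> w = (1/2) *\<^sub>R (b 1 \<and>\<^sub>2 b 2 + b 3 \<and>\<^sub>2 b 4)"
    then obtain b' where "darboux_basis A f p b'" "w = (1/2) *\<^sub>R (b' 1 \<and>\<^sub>2 b' 2 + b' 3 \<and>\<^sub>2 b' 4)"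
      by blast
    then show "w = (1/2) *\<^sub>R (b 1 \<and>\<^sub>2 b 2 + b 3 \<and>\<^sub>2 b 4)"
      by (simp only: eq)
  qed (use b in blast)
  show "gauss_map_2 A f p = (1/2) *\<^sub>R (b 1 \<and>\<^sub>2 b 2 - b 3 \<and>\<^sub>2 b 4)"
    unfolding gauss_map_2_def
  proof (rule the_equality)
    fix w assume "\<exists>b. darboux_basis A f p b \<and> w = (1/2) *\<^sub>R (b 1 \<and>\<^sub>2 b 2 - b 3 \<and>\<^sub>2 b 4)"
    then obtain b' where "darboux_basis A f p b'" "w = (1/2) *\<^sub>R (b' 1 \<and>\<^sub>2 b' 2 - b' 3 \<and>\<^sub>2 b' 4)"
      by blast
    then show "w = (1/2) *\<^sub>R (b 1 \<and>\<^sub>2 b 2 - b 3 \<and>\<^sub>2 b 4)"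
      by (simp only: eq)
  qed (use b in blast)
qed

section \<open>The differential of the Gauss map in a Darboux frame\<close>

text \<open>Differentiate the constant functions \<open>\<langle>e\<^sub>i, e\<^sub>j\<rangle>\<close>. In terms of the connection forms, the lemma
  says \<open>\<omega>\<^sub>i\<^sup>j = - \<omega>\<^sub>j\<^sup>i\<close>.\<close>

lemma differential_of_orthonormal_frame_skew:
  fixes e :: "'i \<Rightarrow> 'a \<Rightarrow> 'v::real_inner"
  assumes S: "oriented_surface X A" and U: "openin X U" and p: "p \<in> U"
    and sm: "\<And>i. smooth_map_on A U (e i)"
    and on: "\<And>q i j. q \<in> U \<Longrightarrow> inner (e i q) (e j q) = (if i = j then 1 else 0)"
  shows "inner (differential A (e i) p v) (e j p) = - inner (differential A (e j) p v) (e i p)"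
proof -
  have p': "p \<in> topspace X"
    using U p openin_subset by blast
  define c where "c = reference_chart A p"
  define E where "E i = e i \<circ> chart_inv c" for i
  define E' where "E' i = frechet_derivative (E i) (at (snd c p))" for i
  have der: "(E i has_derivative E' i) (at (snd c p))" for i
    unfolding E_def E'_def c_def by (rule has_derivative_reference_chart[OF S U p sm])
  have Ep: "E i (snd c p) = e i p" for i
    using chart_inv_reference_chart[OF S p'] by (simp add: E_def c_def)
  have DE: "differential A (e i) p v = E' i (v c)" for i
    by (simp add: differential_eq E'_def E_def c_def)
  \<comment> \<open>On \<open>U\<close>, the functions \<open>?F\<close> and \<open>?\<delta>\<close> coincide. The product rule gives the differential
    of the first, and that of the second is \<open>0\<close>.\<close>
  let ?F = "\<lambda>q. inner (e i q) (e j q)"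
  let ?\<delta> = "\<lambda>q. if i = j then 1 else 0 :: real"
  have "?F \<circ> chart_inv c = (\<lambda>y. inner (E i y) (E j y))"
    by (simp add: E_def comp_def)
  then have "((?F \<circ> chart_inv c) has_derivative
      (\<lambda>h. inner (e i p) (E' j h) + inner (E' i h) (e j p))) (at (snd c p))"
    using has_derivative_inner[OF der der, of i j] by (simp only: Ep)
  then have "differential A ?\<delta> p v = inner (e i p) (E' j (v c)) + inner (E' i (v c)) (e j p)"
    unfolding c_def by (intro differential_eqI[OF S U p, where F = ?F]) (simp_all add: on)
  moreover have "differential A ?\<delta> p v = 0"
    by (rule differential_eqI[OF S U p, where F = ?\<delta>]) (simp_all add: comp_def)
  ultimately show ?thesis
    by (simp add: DE inner_commute add_eq_0_iff)
qed

lemma differential_of_wedges: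
  fixes G :: "'a \<Rightarrow> bivector"
  assumes S: "oriented_surface X A" and U: "openin X U" and p: "p \<in> U"
    and sm: "\<And>i. smooth_map_on A U (e i)"
    and G: "\<And>q. q \<in> U \<Longrightarrow> G q = (1/2) *\<^sub>R (e 1 q \<and>\<^sub>2 e 2 q + s *\<^sub>R (e 3 q \<and>\<^sub>2 e 4 q))"
  shows "differential A G p v = (1/2) *\<^sub>R
      (differential A (e 1) p v \<and>\<^sub>2 e 2 p + e 1 p \<and>\<^sub>2 differential A (e 2) p v +
       s *\<^sub>R (differential A (e 3) p v \<and>\<^sub>2 e 4 p + e 3 p \<and>\<^sub>2 differential A (e 4) p v))"
proof -
  have p': "p \<in> topspace X"
    using U p openin_subset by blast
  define c where "c = reference_chart A p"
  define E where "E i = e i \<circ> chart_inv c" for i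
  define E' where "E' i = frechet_derivative (E i) (at (snd c p))" for i
  have der: "(E i has_derivative E' i) (at (snd c p))" for i
    unfolding E_def E'_def c_def by (rule has_derivative_reference_chart[OF S U p sm])
  have Ep: "E i (snd c p) = e i p" for i
    using chart_inv_reference_chart[OF S p'] by (simp add: E_def c_def)
  have DE: "differential A (e i) p v = E' i (v c)" for i
    by (simp add: differential_eq E'_def E_def c_def)
  let ?F = "\<lambda>q. (1/2) *\<^sub>R (e 1 q \<and>\<^sub>2 e 2 q + s *\<^sub>R (e 3 q \<and>\<^sub>2 e 4 q))"
  have "?F \<circ> chart_inv c = (\<lambda>y. (1/2) *\<^sub>R (E 1 y \<and>\<^sub>2 E 2 y + s *\<^sub>R (E 3 y \<and>\<^sub>2 E 4 y)))"
    by (simp add: E_def comp_def)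
  moreover have "((\<lambda>y. (1/2) *\<^sub>R (E 1 y \<and>\<^sub>2 E 2 y + s *\<^sub>R (E 3 y \<and>\<^sub>2 E 4 y))) has_derivative
      (\<lambda>h. (1/2) *\<^sub>R ((e 1 p \<and>\<^sub>2 E' 2 h + E' 1 h \<and>\<^sub>2 e 2 p) +
         s *\<^sub>R (e 3 p \<and>\<^sub>2 E' 4 h + E' 3 h \<and>\<^sub>2 e 4 p)))) (at (snd c p))"
    unfolding Ep[symmetric]
    by (intro has_derivative_scaleR_right has_derivative_add wedge.FDERIV der)
  ultimately have "differential A G p v =
      (1/2) *\<^sub>R ((e 1 p \<and>\<^sub>2 E' 2 (v c) + E' 1 (v c) \<and>\<^sub>2 e 2 p) +
         s *\<^sub>R (e 3 p \<and>\<^sub>2 E' 4 (v c) + E' 3 (v c) \<and>\<^sub>2 e 4 p))"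
    unfolding c_def by (intro differential_eqI[OF S U p, where F = ?F]) (simp_all add: G)
  then show ?thesis
    by (simp only: DE add.commute)
qed

text \<open>The algebraic core, with \<open>D i\<close> for \<open>de\<^sub>i(v)\<close> and \<open>b i\<close> for \<open>e\<^sub>i\<close>: an infinitesimal rotation of
  the frame acts on \<open>b\<^sub>1 \<and> b\<^sub>2 + s b\<^sub>3 \<and> b\<^sub>4\<close>. Rotations within \<open>span {b\<^sub>1, b\<^sub>2}\<close> and within
  \<open>span {b\<^sub>3, b\<^sub>4}\<close> leave it fixed. Of the four remaining parameters, only two combinations occur.\<close>

lemma skew_derivative_of_wedges:
  fixes b D :: "4 \<Rightarrow> real^4"
  assumes on: "\<And>i j. inner (b i) (b j) = (if i = j then 1 else 0)"
    and skew: "\<And>i j. inner (D i) (b j) = - inner (D j) (b i)"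
    and s: "s * s = 1"
  shows "D 1 \<and>\<^sub>2 b 2 + b 1 \<and>\<^sub>2 D 2 + s *\<^sub>R (D 3 \<and>\<^sub>2 b 4 + b 3 \<and>\<^sub>2 D 4) =
    - ((inner (D 1) (b 3) - s * inner (D 2) (b 4)) *\<^sub>R (b 2 \<and>\<^sub>2 b 3 + s *\<^sub>R (b 1 \<and>\<^sub>2 b 4)))
    - ((inner (D 1) (b 4) + s * inner (D 2) (b 3)) *\<^sub>R (b 2 \<and>\<^sub>2 b 4 + s *\<^sub>R (b 3 \<and>\<^sub>2 b 1)))"
proof -
  define \<omega> where "\<omega> i j = inner (D i) (b j)" for i j
  have ii: "\<omega> i i = 0" for i
    using skew[of i i] by (simp add: \<omega>_def)
  have D: "D i = \<omega> i 1 *\<^sub>R b 1 + \<omega> i 2 *\<^sub>R b 2 + \<omega> i 3 *\<^sub>R b 3 + \<omega> i 4 *\<^sub>R b 4" for i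
    using orthonormal_expansion_4[OF on, of "D i"] by (simp add: sum_4 \<omega>_def)
  have low: "\<omega> 3 1 = - \<omega> 1 3" "\<omega> 3 2 = - \<omega> 2 3" "\<omega> 4 1 = - \<omega> 1 4" "\<omega> 4 2 = - \<omega> 2 4"
    unfolding \<omega>_def by (rule skew)+
  have "s = 1 \<or> s = -1"
    using s by (metis square_eq_1_iff)
  have swap: "b 3 \<and>\<^sub>2 b 1 = - (b 1 \<and>\<^sub>2 b 3)" "b 3 \<and>\<^sub>2 b 2 = - (b 2 \<and>\<^sub>2 b 3)" "b 4 \<and>\<^sub>2 b 2 = - (b 2 \<and>\<^sub>2 b 4)"
    by (rule wedge_commute)+
  with \<open>s = 1 \<or> s = -1\<close> show ?thesis
    unfolding \<omega>_def[symmetric]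
    by (elim disjE) (simp_all add: D[of 1] D[of 2] D[of 3] D[of 4] ii low wedge.add_left wedge.add_right
        wedge.scaleR_left wedge.scaleR_right wedge.minus_left wedge.minus_right
        wedge.diff_left wedge.diff_right swap
        algebra_simps)
qed

text \<open>The bivectors \<open>b\<^sub>i \<and> b\<^sub>j\<close> with \<open>i < j\<close> are orthonormal, so the inner products with \<open>b\<^sub>2 \<and> b\<^sub>3\<close>
  and \<open>b\<^sub>2 \<and> b\<^sub>4\<close> recover the coefficients.\<close>

lemma dual_wedges_independent:
  fixes b :: "4 \<Rightarrow> real^4"
  assumes on: "\<And>i j. inner (b i) (b j) = (if i = j then 1 else 0)"
  shows "- (\<alpha> *\<^sub>R (b 2 \<and>\<^sub>2 b 3 + s *\<^sub>R (b 1 \<and>\<^sub>2 b 4))) - (\<beta> *\<^sub>R (b 2 \<and>\<^sub>2 b 4 + s *\<^sub>R (b 3 \<and>\<^sub>2 b 1))) = 0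
    \<longleftrightarrow> \<alpha> = 0 \<and> \<beta> = 0" (is "?B = 0 \<longleftrightarrow> _")
proof -
  have "inner ?B (b 2 \<and>\<^sub>2 b 3) = - \<alpha>" "inner ?B (b 2 \<and>\<^sub>2 b 4) = - \<beta>"
    by (simp_all add: inner_diff_left inner_add_left inner_wedge det_2 on)
  then show ?thesis
    by force
qed

text \<open>The case \<open>s = 1\<close> is that of the component in \<open>S\<^sub>1\<close>, the case \<open>s = - 1\<close> that of the one
  in \<open>S\<^sub>2\<close>.\<close>

lemma kernel_differential_gauss_component:
  fixes e :: "4 \<Rightarrow> 'a \<Rightarrow> real^4" and G :: "'a \<Rightarrow> bivector"
  assumes S: "oriented_surface X A" and U: "openin X U" and p: "p \<in> U"
    and sm: "\<And>i. smooth_map_on A U (e i)"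
    and on: "\<And>q i j. q \<in> U \<Longrightarrow> inner (e i q) (e j q) = (if i = j then 1 else 0)"
    and G: "\<And>q. q \<in> U \<Longrightarrow> G q = (1/2) *\<^sub>R (e 1 q \<and>\<^sub>2 e 2 q + s *\<^sub>R (e 3 q \<and>\<^sub>2 e 4 q))"
    and s: "s * s = 1"
  shows "kernel_differential A G p = {v \<in> tangent_space A p.
     connection_form A e 1 3 p v - s * connection_form A e 2 4 p v = 0 \<and>
     connection_form A e 1 4 p v + s * connection_form A e 2 3 p v = 0}"
proof -
  have skew: "inner (differential A (e i) p v) (e j p) = - inner (differential A (e j) p v) (e i p)"
    for i j v
    by (rule differential_of_orthonormal_frame_skew[OF S U p]) (use sm on in auto)
  have D: "differential A G p v = (1/2) *\<^sub>R
      (differential A (e 1) p v \<and>\<^sub>2 e 2 p + e 1 p \<and>\<^sub>2 differential A (e 2) p v +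
       s *\<^sub>R (differential A (e 3) p v \<and>\<^sub>2 e 4 p + e 3 p \<and>\<^sub>2 differential A (e 4) p v))" for v
    by (rule differential_of_wedges[OF S U p]) (use sm G in auto)
  have "differential A G p v = 0 \<longleftrightarrow>
     connection_form A e 1 3 p v - s * connection_form A e 2 4 p v = 0 \<and>
     connection_form A e 1 4 p v + s * connection_form A e 2 3 p v = 0" for v
    unfolding D scaleR_eq_0_iff connection_form_def
      skew_derivative_of_wedges[where b = "\<lambda>i. e i p" and D = "\<lambda>i. differential A (e i) p v",
        OF on[OF p] skew s]
      dual_wedges_independent[where b = "\<lambda>i. e i p", OF on[OF p]]
    by simp
  then show ?thesis
    by (simp add: kernel_differential_def)
qed

theorem theorem1:
  fixes X :: "'a topology" and A :: "'a chart set" and f :: "'a \<Rightarrow> real^4"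
    and U :: "'a set" and e :: "4 \<Rightarrow> 'a \<Rightarrow> real^4"
  assumes "oriented_surface X A"
    and "immersion X A f"
    and "darboux_frame X A f U e"
  shows "\<forall>p\<in>U.
    kernel_differential A (gauss_map_1 A f) p =
      kernel_pfaffian A
        (\<lambda>q v. connection_form A e 1 3 q v - connection_form A e 2 4 q v)
        (\<lambda>q v. connection_form A e 1 4 q v + connection_form A e 2 3 q v) p \<and>
    kernel_differential A (gauss_map_2 A f) p =
      kernel_pfaffian A
        (\<lambda>q v. connection_form A e 2 4 q v + connection_form A e 1 3 q v)
        (\<lambda>q v. connection_form A e 1 4 q v - connection_form A e 2 3 q v) p"
proof
  fix p assume p: "p \<in> U"
  have U: "openin X U" and sm: "\<And>i. smooth_map_on A U (e i)"
    and db: "\<And>q. q \<in> U \<Longrightarrow> darboux_basis A f q (\<lambda>i. e i q)"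
    using assms(3) by (auto simp: darboux_frame_def)
  have on: "inner (e i q) (e j q) = (if i = j then 1 else 0)" if "q \<in> U" for q i j
    using db[OF that] by (simp add: darboux_basis_def)
  have g: "gauss_map_1 A f q = (1/2) *\<^sub>R (e 1 q \<and>\<^sub>2 e 2 q + 1 *\<^sub>R (e 3 q \<and>\<^sub>2 e 4 q))"
    "gauss_map_2 A f q = (1/2) *\<^sub>R (e 1 q \<and>\<^sub>2 e 2 q + (- 1) *\<^sub>R (e 3 q \<and>\<^sub>2 e 4 q))" if "q \<in> U" for q
    using gauss_map_eq[OF assms(1,2) _ db[OF that]] openin_subset[OF U] that by auto
  have kernel: "kernel_differential A G p = {v \<in> tangent_space A p.
      connection_form A e 1 3 p v - s * connection_form A e 2 4 p v = 0 \<and>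
      connection_form A e 1 4 p v + s * connection_form A e 2 3 p v = 0}"
    if "\<And>q. q \<in> U \<Longrightarrow> G q = (1/2) *\<^sub>R (e 1 q \<and>\<^sub>2 e 2 q + s *\<^sub>R (e 3 q \<and>\<^sub>2 e 4 q))" "s * s = 1"
    for G s
    by (rule kernel_differential_gauss_component[OF assms(1) U p]) (use sm on that in auto)
  show "kernel_differential A (gauss_map_1 A f) p =
      kernel_pfaffian A
        (\<lambda>q v. connection_form A e 1 3 q v - connection_form A e 2 4 q v)
        (\<lambda>q v. connection_form A e 1 4 q v + connection_form A e 2 3 q v) p \<and>
    kernel_differential A (gauss_map_2 A f) p =
      kernel_pfaffian A
        (\<lambda>q v. connection_form A e 2 4 q v + connection_form A e 1 3 q v)
        (\<lambda>q v. connection_form A e 1 4 q v - connection_form A e 2 3 q v) p"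
    unfolding kernel_pfaffian_def kernel[of "gauss_map_1 A f" 1, OF g(1), simplified]
      kernel[of "gauss_map_2 A f" "- 1", OF g(2), simplified]
    by (simp add: add.commute)
qed

end
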